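(* Let $\hat{\boldsymbol z}$ denote an optimal solution of the problem $$\hat\vartheta:=\max_{\boldsymbol z\in Z}\ \min_{u\in\mathcal{U}}\ \mathbb{E}_P[u(\boldsymbol f(\boldsymbol z,\boldsymbol\xi))]\quad\text{s.t. }\ \mathbb{E}_P[u(\boldsymbol g(\boldsymbol z,\boldsymbol\xi))]\ge c,$$ and let $$\tilde Z:=\Big\{\boldsymbol z\in Z:\ \inf_{u\in\mathcal{U}}\mathbb{E}_P[u(\boldsymbol g(\boldsymbol z,\boldsymbol\xi))]-c\ge0\Big\}.$$ Let $\tilde\vartheta$ be the optimal value of the problem $$\tilde\vartheta:=\max_{\boldsymbol z\in Z}\ \min_{u\in\mathcal{U}}\ \mathbb{E}_P[u(\boldsymbol f(\boldsymbol z,\boldsymbol\xi))]\quad\text{s.t. }\ \min_{u\in\mathcal{U}}\ \mathbb{E}_P[u(\boldsymbol g(\boldsymbol z,\boldsymbol\xi))]\ge c.$$ If $\hat{\boldsymbol z}\in\tilde Z$, then $\hat\vartheta=\tilde\vartheta$.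
   Context: $T=[\underline x,\bar x]\times[\underline y,\bar y]$; $Z\subset\mathbb{R}^n$ is compact and convex; $\boldsymbol f,\boldsymbol g:\mathbb{R}^n\times\mathbb{R}^m\to\mathbb{R}^2$ are continuous with ranges covered by $T$; $\boldsymbol\xi$ is a random vector with distribution $P$ and compact support; $c\in\mathbb{R}$ is a constant. $\mathcal{U}$ is a non-empty ambiguity set of utility functions: $\mathcal{U}=\{u\in\mathscr{U}:\int_Tu\,d\psi_l\le c_l,\ l=1,\dots,M\}$ (Lebesgue–Stieltjes integrals, assumed well-defined, for given $\psi_l:T\to\mathbb{R}$, $c_l\in\mathbb{R}$), where $\mathscr{U}$ is the set of continuous, componentwise non-decreasing functions $u:T\to[0,1]$ with $u(\underline x,\underline y)=0$, $u(\bar x,\bar y)=1$ and $u(x_0,y_1)+u(x_1,y_0)\ge u(x_0,y_0)+u(x_1,y_1)$ whenever $x_0<x_1$, $y_0<y_1$. In the first problem the constraint $\mathbb{E}_P[u(\boldsymbol g(\boldsymbol z,\boldsymbol\xi))]\ge c$ belongs to the inner minimization over $u$, i.e. $\hat\vartheta=\max_{\boldsymbol z\in Z}\min_{u\in\mathcal{U}(\boldsymbol z)}\mathbb{E}_P[u(\boldsymbol f(\boldsymbol z,\boldsymbol\xi))]$ with $\mathcal{U}(\boldsymbol z)=\{u\in\mathcal{U}:\mathbb{E}_P[u(\boldsymbol g(\boldsymbol z,\boldsymbol\xi))]\ge c\}$. In the second problem the constraint is on $\boldsymbol z$ (its feasible set is $\tilde Z$), and the minimizing $u$ in the objective and in the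 constraint may differ. *)

theory Defs
  imports "HOL-Probability.Probability"
begin

definition rectangle :: "real \<Rightarrow> real \<Rightarrow> real \<Rightarrow> real \<Rightarrow> (real \<times> real) set" where
  "rectangle xl xu yl yu = {xl..xu} \<times> {yl..yu}"

text \<open>
  A function \<open>\<psi>\<close> on the closed rectangle \<open>T\<close> induces a signed Borel measure on \<open>T\<close>, represented
  here as a difference of two finite measures.  As for bivariate distribution functions, \<open>\<psi>\<close> is
  extended by \<open>0\<close> to the left of and below \<open>T\<close> (so the left and lower edges of \<open>T\<close> can carry mass,
  and \<open>\<integral>\<^sub>T u dF\<close> is the expectation of \<open>u\<close> when \<open>F\<close> is the distribution function of a law on \<open>T\<close>)
  and constantly, via \<open>min\<close>, beyond the right and upper edges.  With this extension the mass of
  \<open>[xl, x] \<times> [yl, y]\<close> determines all increments over half-open boxes.  Taking the upper-right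
  limit of \<open>\<psi>\<close> is the usual normalisation, which avoids requiring right-continuity.
\<close>

definition stieltjes_measures ::
    "real \<Rightarrow> real \<Rightarrow> real \<Rightarrow> real \<Rightarrow> (real \<times> real \<Rightarrow> real) \<Rightarrow>
     (real \<times> real) measure \<Rightarrow> (real \<times> real) measure \<Rightarrow> bool" where
  "stieltjes_measures xl xu yl yu \<psi> \<mu> \<nu> \<longleftrightarrow>
     finite_measure \<mu> \<and> sets \<mu> = sets (restrict_space borel (rectangle xl xu yl yu)) \<and>
     finite_measure \<nu> \<and> sets \<nu> = sets (restrict_space borel (rectangle xl xu yl yu)) \<and>
     (\<forall>x\<in>{xl..xu}. \<forall>y\<in>{yl..yu}.
        ((\<lambda>(s, t). \<psi> (min s xu, min t yu)) \<longlongrightarrow>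
           measure \<mu> ({xl..x} \<times> {yl..y}) - measure \<nu> ({xl..x} \<times> {yl..y}))
          (at (x, y) within {x<..} \<times> {y<..}))"

definition stieltjes_integrator ::
    "real \<Rightarrow> real \<Rightarrow> real \<Rightarrow> real \<Rightarrow> (real \<times> real \<Rightarrow> real) \<Rightarrow> bool" where
  "stieltjes_integrator xl xu yl yu \<psi> \<longleftrightarrow> (\<exists>\<mu> \<nu>. stieltjes_measures xl xu yl yu \<psi> \<mu> \<nu>)"

text \<open>
  The integral does not depend on the representing pair of measures; see
  \<open>stieltjes_integral_eq\<close> below.
\<close>

definition stieltjes_integral ::
    "real \<Rightarrow> real \<Rightarrow> real \<Rightarrow> real \<Rightarrow> (real \<times> real \<Rightarrow> real) \<Rightarrow> (real \<times> real \<Rightarrow> real) \<Rightarrow> real" where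
  "stieltjes_integral xl xu yl yu u \<psi> =
     (THE I. \<exists>\<mu> \<nu>. stieltjes_measures xl xu yl yu \<psi> \<mu> \<nu> \<and>
        I = (\<integral>p. u p \<partial>\<mu>) - (\<integral>p. u p \<partial>\<nu>))"

text \<open>
  Functions on \<open>T\<close> are represented by total functions; values off \<open>T\<close> are irrelevant throughout.
\<close>

definition utility_functions ::
    "real \<Rightarrow> real \<Rightarrow> real \<Rightarrow> real \<Rightarrow> (real \<times> real \<Rightarrow> real) set" where
  "utility_functions xl xu yl yu =
     {u. continuous_on (rectangle xl xu yl yu) u \<and>
         u ` rectangle xl xu yl yu \<subseteq> {0..1} \<and>
         (\<forall>x\<in>{xl..xu}. \<forall>x'\<in>{xl..xu}. \<forall>y\<in>{yl..yu}. x \<le> x' \<longrightarrow> u (x, y) \<le> u (x', y)) \<and>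
         (\<forall>x\<in>{xl..xu}. \<forall>y\<in>{yl..yu}. \<forall>y'\<in>{yl..yu}. y \<le> y' \<longrightarrow> u (x, y) \<le> u (x, y')) \<and>
         u (xl, yl) = 0 \<and> u (xu, yu) = 1 \<and>
         (\<forall>x0\<in>{xl..xu}. \<forall>x1\<in>{xl..xu}. \<forall>y0\<in>{yl..yu}. \<forall>y1\<in>{yl..yu}.
            x0 < x1 \<longrightarrow> y0 < y1 \<longrightarrow> u (x0, y1) + u (x1, y0) \<ge> u (x0, y0) + u (x1, y1))}"

definition ambiguity_set ::
    "real \<Rightarrow> real \<Rightarrow> real \<Rightarrow> real \<Rightarrow> nat \<Rightarrow> (nat \<Rightarrow> real \<times> real \<Rightarrow> real) \<Rightarrow> (nat \<Rightarrow> real) \<Rightarrow>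
     (real \<times> real \<Rightarrow> real) set" where
  "ambiguity_set xl xu yl yu M \<psi> b =
     {u \<in> utility_functions xl xu yl yu.
        \<forall>l\<in>{1..M}. stieltjes_integral xl xu yl yu u (\<psi> l) \<le> b l}"

definition measure_support :: "'a::topological_space measure \<Rightarrow> 'a set" where
  "measure_support P = {x. \<forall>V. open V \<longrightarrow> x \<in> V \<longrightarrow> emeasure P V > 0}"

definition expected_utility ::
    "'m measure \<Rightarrow> ('z \<times> 'm \<Rightarrow> real \<times> real) \<Rightarrow> (real \<times> real \<Rightarrow> real) \<Rightarrow> 'z \<Rightarrow> real" where
  "expected_utility P h u z = (\<integral>\<xi>. u (h (z, \<xi>)) \<partial>P)"

definition worst_case_utility ::
    "'m measure \<Rightarrow> (real \<times> real \<Rightarrow> real) set \<Rightarrow> ('z \<times> 'm \<Rightarrow> real \<times> real) \<Rightarrow> 'z \<Rightarrow> ereal" where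
  "worst_case_utility P U h z = (INF u\<in>U. ereal (expected_utility P h u z))"

definition restricted_ambiguity_set ::
    "'m measure \<Rightarrow> (real \<times> real \<Rightarrow> real) set \<Rightarrow> ('z \<times> 'm \<Rightarrow> real \<times> real) \<Rightarrow> real \<Rightarrow> 'z \<Rightarrow>
     (real \<times> real \<Rightarrow> real) set" where
  "restricted_ambiguity_set P U g c z = {u \<in> U. expected_utility P g u z \<ge> c}"

text \<open>
  Optimal values are extended real: an infeasible inner minimisation has value \<open>\<infinity>\<close>, and an
  infeasible outer maximisation has value \<open>-\<infinity>\<close>.
\<close>

definition hat_objective ::
    "'m measure \<Rightarrow> (real \<times> real \<Rightarrow> real) set \<Rightarrow> ('z \<times> 'm \<Rightarrow> real \<times> real) \<Rightarrow>
     ('z \<times> 'm \<Rightarrow> real \<times> real) \<Rightarrow> real \<Rightarrow> 'z \<Rightarrow> ereal" where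
  "hat_objective P U f g c z = worst_case_utility P (restricted_ambiguity_set P U g c z) f z"

definition hat_value ::
    "'m measure \<Rightarrow> 'z set \<Rightarrow> (real \<times> real \<Rightarrow> real) set \<Rightarrow> ('z \<times> 'm \<Rightarrow> real \<times> real) \<Rightarrow>
     ('z \<times> 'm \<Rightarrow> real \<times> real) \<Rightarrow> real \<Rightarrow> ereal" where
  "hat_value P Z U f g c = (SUP z\<in>Z. hat_objective P U f g c z)"

definition tilde_feasible ::
    "'m measure \<Rightarrow> 'z set \<Rightarrow> (real \<times> real \<Rightarrow> real) set \<Rightarrow> ('z \<times> 'm \<Rightarrow> real \<times> real) \<Rightarrow> real \<Rightarrow>
     'z set" where
  "tilde_feasible P Z U g c = {z \<in> Z. worst_case_utility P U g z - ereal c \<ge> 0}"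

definition tilde_value ::
    "'m measure \<Rightarrow> 'z set \<Rightarrow> (real \<times> real \<Rightarrow> real) set \<Rightarrow> ('z \<times> 'm \<Rightarrow> real \<times> real) \<Rightarrow>
     ('z \<times> 'm \<Rightarrow> real \<times> real) \<Rightarrow> real \<Rightarrow> ereal" where
  "tilde_value P Z U f g c =
     (SUP z\<in>{z \<in> Z. worst_case_utility P U g z \<ge> ereal c}. worst_case_utility P U f z)"

lemma stieltjes_measures_unique:
  assumes 1: "stieltjes_measures xl xu yl yu \<psi> \<mu>1 \<nu>1"
    and 2: "stieltjes_measures xl xu yl yu \<psi> \<mu>2 \<nu>2"
    and le: "xl \<le> xu" "yl \<le> yu"
    and A: "A \<in> sets \<mu>1"
  shows "measure \<mu>1 A + measure \<nu>2 A = measure \<mu>2 A + measure \<nu>1 A"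
proof -
  define T where "T = rectangle xl xu yl yu"
  define G where "G = (\<inter>) T ` range (\<lambda>p :: real \<times> real. {..p})"
  have fin: "finite_measure \<mu>1" "finite_measure \<nu>1" "finite_measure \<mu>2" "finite_measure \<nu>2"
    and S: "sets \<mu>1 = sets (restrict_space borel T)" "sets \<nu>1 = sets (restrict_space borel T)"
       "sets \<mu>2 = sets (restrict_space borel T)" "sets \<nu>2 = sets (restrict_space borel T)"
    using 1 2 by (auto simp: stieltjes_measures_def T_def)
  have sp: "space \<mu>1 = T" "space \<nu>1 = T" "space \<mu>2 = T" "space \<nu>2 = T"
    using S[THEN sets_eq_imp_space_eq] by (auto simp: space_restrict_space)
  have TB: "T \<in> sigma_sets UNIV (range (\<lambda>p :: real \<times> real. {..p}))"
  proof -
    have "T \<in> sets borel" by (simp add: T_def rectangle_def borel_closed closed_Times)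
    then show ?thesis by (simp add: borel_eq_atMost)
  qed
  have gen: "sets (restrict_space borel T) = sigma_sets T G"
    unfolding sets_restrict_space G_def
    using sigma_sets_Int[of T UNIV "range (\<lambda>p. {..p})"] TB
    by (simp add: borel_eq_atMost)
  have box: "measure \<mu>1 B + measure \<nu>2 B = measure \<mu>2 B + measure \<nu>1 B"
    if B: "B = {xl..x} \<times> {yl..y}" and xy: "x \<in> {xl..xu}" "y \<in> {yl..yu}" for B x y
  proof -
    have nb: "at (x, y) within {x<..} \<times> {y<..} \<noteq> bot"
      by (simp add: trivial_limit_within islimpt_in_closure closure_Times)
    have "measure \<mu>1 B - measure \<nu>1 B = measure \<mu>2 B - measure \<nu>2 B"
      using 1 2 xy unfolding stieltjes_measures_def B
      by (intro tendsto_unique[OF nb, where f = "\<lambda>(s, t). \<psi> (min s xu, min t yu)"]) blast+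
    then show ?thesis by simp
  qed
  have G: "measure \<mu>1 B + measure \<nu>2 B = measure \<mu>2 B + measure \<nu>1 B" if BG: "B \<in> G" for B
  proof -
    obtain q where "B = T \<inter> {..q}" using BG unfolding G_def by blast
    then obtain a b where B: "B = T \<inter> {..(a, b)}" by (cases q) simp
    show ?thesis
    proof (cases "xl \<le> a \<and> yl \<le> b")
      case True
      have "B = {xl..min a xu} \<times> {yl..min b yu}"
        unfolding B T_def rectangle_def by (auto simp: less_eq_prod_def)
      then show ?thesis using True le by (intro box) auto
    next
      case False
      have "B = {}" unfolding B T_def rectangle_def using False by (auto simp: less_eq_prod_def)
      then show ?thesis by simp
    qed
  qed
  have T: "measure \<mu>1 T + measure \<nu>2 T = measure \<mu>2 T + measure \<nu>1 T"
    using le by (intro box[of _ xu yu]) (auto simp: T_def rectangle_def)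
  have stable: "Int_stable G"
  proof (rule Int_stableI)
    fix a b assume "a \<in> G" "b \<in> G"
    then obtain p q where "a = T \<inter> {..p}" "b = T \<inter> {..q}" by (auto simp: G_def)
    then have "a \<inter> b = T \<inter> {..inf p q}" by auto
    then show "a \<inter> b \<in> G" by (auto simp: G_def)
  qed
  have GP: "G \<subseteq> Pow T" by (auto simp: G_def)
  have "A \<in> sigma_sets T G" using A S gen by simp
  from stable GP this show ?thesis
  proof (induct rule: sigma_sets_induct_disjoint)
    case (basic A) then show ?case by (rule G)
  next
    case empty then show ?case by simp
  next
    case (compl A)
    have m: "A \<in> sets \<mu>1" "A \<in> sets \<nu>1" "A \<in> sets \<mu>2" "A \<in> sets \<nu>2"
      using compl(1) S gen by auto
    show ?case
      using finite_measure.finite_measure_compl[OF fin(1) m(1)]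
        finite_measure.finite_measure_compl[OF fin(2) m(2)]
        finite_measure.finite_measure_compl[OF fin(3) m(3)]
        finite_measure.finite_measure_compl[OF fin(4) m(4)] compl(2) T sp by simp
  next
    case (union F)
    have m: "range F \<subseteq> sets \<mu>1" "range F \<subseteq> sets \<nu>1" "range F \<subseteq> sets \<mu>2" "range F \<subseteq> sets \<nu>2"
      using union(2) S gen by auto
    note u = finite_measure.finite_measure_UNION[OF _ _ union(1)]
    have s1: "(\<lambda>i. measure \<mu>1 (F i) + measure \<nu>2 (F i)) sums
        (measure \<mu>1 (\<Union>i. F i) + measure \<nu>2 (\<Union>i. F i))"
      by (intro sums_add u fin m)
    have s2: "(\<lambda>i. measure \<mu>2 (F i) + measure \<nu>1 (F i)) sums
        (measure \<mu>2 (\<Union>i. F i) + measure \<nu>1 (\<Union>i. F i))"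
      by (intro sums_add u fin m)
    show ?case using s1 s2 union(3) by (simp add: sums_unique2)
  qed
qed

lemma stieltjes_integral_eq:
  assumes 1: "stieltjes_measures xl xu yl yu \<psi> \<mu> \<nu>"
    and le: "xl \<le> xu" "yl \<le> yu"
    and u: "u \<in> utility_functions xl xu yl yu"
  shows "stieltjes_integral xl xu yl yu u \<psi> = (\<integral>p. u p \<partial>\<mu>) - (\<integral>p. u p \<partial>\<nu>)"
  unfolding stieltjes_integral_def
proof (rule the_equality)
  show "\<exists>\<mu>' \<nu>'. stieltjes_measures xl xu yl yu \<psi> \<mu>' \<nu>' \<and>
      (\<integral>p. u p \<partial>\<mu>) - (\<integral>p. u p \<partial>\<nu>) = (\<integral>p. u p \<partial>\<mu>') - (\<integral>p. u p \<partial>\<nu>')"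
    using 1 by blast
next
  fix I
  assume "\<exists>\<mu>' \<nu>'. stieltjes_measures xl xu yl yu \<psi> \<mu>' \<nu>' \<and>
    I = (\<integral>p. u p \<partial>\<mu>') - (\<integral>p. u p \<partial>\<nu>')"
  then obtain \<mu>' \<nu>' where 2: "stieltjes_measures xl xu yl yu \<psi> \<mu>' \<nu>'"
    and I: "I = (\<integral>p. u p \<partial>\<mu>') - (\<integral>p. u p \<partial>\<nu>')" by blast
  define T where "T = rectangle xl xu yl yu"
  have fin: "finite_measure \<mu>" "finite_measure \<nu>" "finite_measure \<mu>'" "finite_measure \<nu>'"
    and S: "sets \<mu> = sets (restrict_space borel T)" "sets \<nu> = sets (restrict_space borel T)"
       "sets \<mu>' = sets (restrict_space borel T)" "sets \<nu>' = sets (restrict_space borel T)"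
    using 1 2 by (auto simp: stieltjes_measures_def T_def)
  have sp: "space \<mu> = T" "space \<nu> = T" "space \<mu>' = T" "space \<nu>' = T"
    using S[THEN sets_eq_imp_space_eq] by (auto simp: space_restrict_space)
  have um: "u \<in> borel_measurable (restrict_space borel T)"
    using u by (intro borel_measurable_continuous_on_restrict) (auto simp: utility_functions_def T_def)
  have ub: "0 \<le> u p" "u p \<le> 1" if "p \<in> T" for p
    using u that by (auto simp: utility_functions_def T_def)
  have em: "emeasure \<mu> A + emeasure \<nu>' A = emeasure \<mu>' A + emeasure \<nu> A"
    if "A \<in> sets (restrict_space borel T)" for A
    using stieltjes_measures_unique[OF 1 2 le, of A] that S
      fin[THEN finite_measure.emeasure_eq_measure]
    by (simp flip: ennreal_plus)
  have nn: "(\<integral>\<^sup>+p. h p \<partial>\<mu>) + (\<integral>\<^sup>+p. h p \<partial>\<nu>') = (\<integral>\<^sup>+p. h p \<partial>\<mu>') + (\<integral>\<^sup>+p. h p \<partial>\<nu>)"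
    if "h \<in> borel_measurable (restrict_space borel T)" for h :: "real \<times> real \<Rightarrow> ennreal"
    using that
  proof (induct rule: borel_measurable_induct)
    case (cong f g)
    then show ?case
      by (simp add: sp space_restrict_space cong: nn_integral_cong_simp)
  next
    case (set A)
    then show ?case using em[of A] S by simp
  next
    case (mult v c)
    note [measurable] = mult(2)
    have "(\<integral>\<^sup>+p. c * v p \<partial>K) = c * (\<integral>\<^sup>+p. v p \<partial>K)"
      if "sets K = sets (restrict_space borel T)" for K
    proof -
      note [measurable_cong] = that
      show ?thesis by (rule nn_integral_cmult) measurable
    qed
    then show ?case using mult S by (simp only: flip: distrib_left)
  next
    case (add v w)
    note [measurable] = add(1) add(4)
    have *: "(\<integral>\<^sup>+p. w p + v p \<partial>K) = (\<integral>\<^sup>+p. w p \<partial>K) + (\<integral>\<^sup>+p. v p \<partial>K)"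
      if "sets K = sets (restrict_space borel T)" for K
    proof -
      note [measurable_cong] = that
      show ?thesis by (rule nn_integral_add) measurable
    qed
    have rearrange: "(a + b) + (a' + b') = (a + a') + (b + b')" for a b a' b' :: ennreal
      by (simp add: ac_simps)
    have "(\<integral>\<^sup>+p. w p \<partial>\<mu>) + (\<integral>\<^sup>+p. v p \<partial>\<mu>) + ((\<integral>\<^sup>+p. w p \<partial>\<nu>') + (\<integral>\<^sup>+p. v p \<partial>\<nu>')) =
        ((\<integral>\<^sup>+p. w p \<partial>\<mu>) + (\<integral>\<^sup>+p. w p \<partial>\<nu>')) + ((\<integral>\<^sup>+p. v p \<partial>\<mu>) + (\<integral>\<^sup>+p. v p \<partial>\<nu>'))"
      by (rule rearrange)
    also have "\<dots> = ((\<integral>\<^sup>+p. w p \<partial>\<mu>') + (\<integral>\<^sup>+p. w p \<partial>\<nu>)) + ((\<integral>\<^sup>+p. v p \<partial>\<mu>') + (\<integral>\<^sup>+p. v p \<partial>\<nu>))"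
      using add by (simp only:)
    also have "\<dots> = (\<integral>\<^sup>+p. w p \<partial>\<mu>') + (\<integral>\<^sup>+p. v p \<partial>\<mu>') + ((\<integral>\<^sup>+p. w p \<partial>\<nu>) + (\<integral>\<^sup>+p. v p \<partial>\<nu>))"
      by (rule rearrange)
    finally show ?case
      unfolding *[OF S(1)] *[OF S(2)] *[OF S(3)] *[OF S(4)] .
  next
    case (seq V)
    note [measurable] = seq(1)
    have mono: "incseq (\<lambda>i. \<integral>\<^sup>+p. V i p \<partial>K)" for K
      using seq(4) by (auto simp: incseq_def le_fun_def intro!: nn_integral_mono)
    have sup: "(\<integral>\<^sup>+p. (SUP i. V i) p \<partial>K) = (SUP i. \<integral>\<^sup>+p. V i p \<partial>K)"
      if "sets K = sets (restrict_space borel T)" for K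
    proof -
      note [measurable_cong] = that
      show ?thesis
        unfolding SUP_apply by (rule nn_integral_monotone_convergence_SUP[OF seq(4)]) measurable
    qed
    show ?case
      unfolding sup[OF S(1)] sup[OF S(2)] sup[OF S(3)] sup[OF S(4)]
        ennreal_SUP_add[OF mono mono, symmetric]
      by (simp only: seq(3))
  qed
  have int: "integrable K u" and eq: "(\<integral>\<^sup>+p. ennreal (u p) \<partial>K) = ennreal (\<integral>p. u p \<partial>K)"
    and pos: "(\<integral>p. u p \<partial>K) \<ge> 0"
    if "finite_measure K" "sets K = sets (restrict_space borel T)" "space K = T" for K
  proof -
    show int: "integrable K u"
      using that ub um
      by (intro finite_measure.integrable_const_bound[of _ _ 1])
         (auto simp: measurable_cong_sets[OF that(2) refl])
    show "(\<integral>\<^sup>+p. ennreal (u p) \<partial>K) = ennreal (\<integral>p. u p \<partial>K)"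
      using int ub that by (intro nn_integral_eq_integral) auto
    show "(\<integral>p. u p \<partial>K) \<ge> 0" using ub that by (intro integral_nonneg_AE) auto
  qed
  have "(\<integral>p. u p \<partial>\<mu>) + (\<integral>p. u p \<partial>\<nu>') = (\<integral>p. u p \<partial>\<mu>') + (\<integral>p. u p \<partial>\<nu>)"
    using nn[of "\<lambda>p. ennreal (u p)"] um
    by (simp add: eq pos fin S sp flip: ennreal_plus)
  then show "I = (\<integral>p. u p \<partial>\<mu>) - (\<integral>p. u p \<partial>\<nu>)" using I by simp
qed

end

theory Submission
  imports Defs
begin

text \<open>
  At a point \<open>z\<close> where the constraint holds for \<^emph>\<open>every\<close> \<open>u \<in> U\<close>, imposing it on \<open>u\<close> in the
  inner minimisation removes nothing, so the objectives of the two problems coincide there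
  (\<open>hat_objective_eq_if_robustly_feasible\<close>).  The second problem is therefore the first one with
  the outer maximisation restricted to robustly feasible points, and its value cannot exceed that
  of the first (\<open>tilde_value_le_hat_value\<close>).  If a maximiser of the first problem lies in the
  smaller feasible set, the restriction loses nothing and the values agree.
\<close>

lemma restricted_ambiguity_set_eq_if_robustly_feasible:
  assumes "worst_case_utility P U g z \<ge> ereal c"
  shows "restricted_ambiguity_set P U g c z = U"
proof -
  have "expected_utility P g u z \<ge> c" if "u \<in> U" for u
  proof -
    have "ereal c \<le> ereal (expected_utility P g u z)"
      using assms INF_lower[OF that] unfolding worst_case_utility_def by (rule order_trans)
    then show ?thesis by simp
  qed
  then show ?thesis by (auto simp: restricted_ambiguity_set_def)
qed

lemma hat_objective_eq_if_robustly_feasible: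
  assumes "worst_case_utility P U g z \<ge> ereal c"
  shows "hat_objective P U f g c z = worst_case_utility P U f z"
  by (simp add: hat_objective_def restricted_ambiguity_set_eq_if_robustly_feasible[OF assms])

lemma mem_tilde_feasible_iff:
  "z \<in> tilde_feasible P Z U g c \<longleftrightarrow> z \<in> Z \<and> worst_case_utility P U g z \<ge> ereal c"
  by (cases "worst_case_utility P U g z") (auto simp: tilde_feasible_def)

text \<open>
  The two objectives agree on the robustly feasible points, a subset of \<open>Z\<close>.  The inequality can
  be strict: elsewhere in \<open>Z\<close> the first problem can attain a larger value, even \<open>\<infinity>\<close> where no
  \<open>u \<in> U\<close> satisfies the constraint.
\<close>

lemma tilde_value_le_hat_value:
  "tilde_value P Z U f g c \<le> hat_value P Z U f g c"
  unfolding tilde_value_def hat_value_def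
  by (rule SUP_subset_mono) (auto simp: hat_objective_eq_if_robustly_feasible)

lemma SUP_eq_if_is_arg_max:
  fixes h :: "'a \<Rightarrow> 'b :: {complete_lattice, linorder}"
  assumes "is_arg_max h (\<lambda>z. z \<in> Z) z0"
  shows "(SUP z\<in>Z. h z) = h z0"
  using assms by (intro antisym SUP_least SUP_upper) (auto simp: is_arg_max_linorder)

theorem proposition6p1:
  fixes xl xu yl yu c :: real
    and Z :: "(real ^ 'n) set"
    and f g :: "(real ^ 'n) \<times> (real ^ 'm) \<Rightarrow> real \<times> real"
    and \<Omega> :: "'w measure" and \<xi> :: "'w \<Rightarrow> real ^ 'm" and P :: "(real ^ 'm) measure"
    and M :: nat and \<psi> :: "nat \<Rightarrow> real \<times> real \<Rightarrow> real" and b :: "nat \<Rightarrow> real"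
    and U :: "(real \<times> real \<Rightarrow> real) set"
    and zhat :: "real ^ 'n"
  assumes "xl \<le> xu" and "yl \<le> yu"
    and "compact Z" and "convex Z"
    and "continuous_on UNIV f" and "range f \<subseteq> rectangle xl xu yl yu"
    and "continuous_on UNIV g" and "range g \<subseteq> rectangle xl xu yl yu"
    and "prob_space \<Omega>" and "\<xi> \<in> borel_measurable \<Omega>" and "P = distr \<Omega> borel \<xi>"
    and "compact (measure_support P)"
    and "\<forall>l\<in>{1..M}. stieltjes_integrator xl xu yl yu (\<psi> l)"
    and "U = ambiguity_set xl xu yl yu M \<psi> b" and "U \<noteq> {}"
    and "is_arg_max (hat_objective P U f g c) (\<lambda>z. z \<in> Z) zhat"
    and "zhat \<in> tilde_feasible P Z U g c"
  shows "hat_value P Z U f g c = tilde_value P Z U f g c"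
proof (rule antisym)
  from \<open>zhat \<in> tilde_feasible P Z U g c\<close>
  have zhat: "zhat \<in> Z" "worst_case_utility P U g zhat \<ge> ereal c"
    by (simp_all add: mem_tilde_feasible_iff)
  have "hat_value P Z U f g c = hat_objective P U f g c zhat"
    unfolding hat_value_def
    using \<open>is_arg_max (hat_objective P U f g c) (\<lambda>z. z \<in> Z) zhat\<close> by (rule SUP_eq_if_is_arg_max)
  also have "\<dots> = worst_case_utility P U f zhat"
    using zhat(2) by (rule hat_objective_eq_if_robustly_feasible)
  also have "\<dots> \<le> tilde_value P Z U f g c"
    unfolding tilde_value_def using zhat by (intro SUP_upper) simp
  finally show "hat_value P Z U f g c \<le> tilde_value P Z U f g c" .
qed (rule tilde_value_le_hat_value)

end
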